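(* Let $D_{11}>0$, $v_0\in\mathbb{R}$, $c_a^0\in\mathbb{R}$, and let $c_p:[0,+\infty)\to\mathbb{R}$ be of class $\mathcal{C}^1$. For fixed $x\in[0,+\infty)$ and $t>0$, $$\lim_{L\to+\infty}c_L(x,t)=c_\infty(x,t),$$ where $$c_L(x,t)=c_a^0+\int_0^t g_L(x,\tau)\big(c_a^0-c_p(t-\tau)\big)\,d\tau,\qquad c_\infty(x,t)=c_a^0+\int_0^t g_\infty(x,\tau)\big(c_a^0-c_p(t-\tau)\big)\,d\tau.$$
   Context: Put $\alpha=\frac{v_0}{2D_{11}}$ and $s_0=-\frac{v_0^2}{4D_{11}^2}$. For $L>0$, $x>0$, $\tau>0$, $$g_L(x,\tau)=-\frac{e^{\alpha x+D_{11}s_0\tau}}{2\sqrt{\pi D_{11}\tau^3}}\sum_{n\in\mathbb{Z}}(x+2nL)\,e^{-\frac{(x+2nL)^2}{4D_{11}\tau}},\qquad g_\infty(x,\tau)=-\frac{x}{2\sqrt{\pi D_{11}\tau^3}}\,e^{-\frac{(x-v_0\tau)^2}{4D_{11}\tau}}.$$ For $x=0$, both $g_L(0,\cdot)$ and $g_\infty(0,\cdot)$ are understood as the distribution $-\delta_0$ (minus the Dirac mass at $\tau=0$), so that for $x=0$ each of the two integrals is by convention equal to $-(c_a^0-c_p(t))$, i.e. $c_L(0,t)=c_\infty(0,t)=c_p(t)$. *)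

theory Defs
  imports "HOL-Analysis.Analysis" "HOL-Probability.Giry_Monad"
begin

definition alpha :: "real \<Rightarrow> real \<Rightarrow> real" where
  "alpha D v = v / (2 * D)"

definition s0 :: "real \<Rightarrow> real \<Rightarrow> real" where
  "s0 D v = - (v\<^sup>2 / (4 * D\<^sup>2))"

text \<open>Throughout, \<open>D\<close> and \<open>v\<close> stand for \<open>D\<^sub>1\<^sub>1\<close> and \<open>v\<^sub>0\<close>. The following two
  formulas are meant for \<open>x > 0\<close> and \<open>\<tau> > 0\<close> (and \<open>L > 0\<close>), where the series over the
  integers is absolutely convergent.\<close>

definition g_L :: "real \<Rightarrow> real \<Rightarrow> real \<Rightarrow> real \<Rightarrow> real \<Rightarrow> real" where
  "g_L D v L x \<tau> =
     - (exp (alpha D v * x + D * s0 D v * \<tau>) / (2 * sqrt (pi * D * \<tau> ^ 3)))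
     * (\<Sum>\<^sub>\<infinity>n\<in>(UNIV :: int set).
          (x + 2 * of_int n * L) * exp (- ((x + 2 * of_int n * L)\<^sup>2 / (4 * D * \<tau>))))"

definition g_inf :: "real \<Rightarrow> real \<Rightarrow> real \<Rightarrow> real \<Rightarrow> real" where
  "g_inf D v x \<tau> =
     - (x / (2 * sqrt (pi * D * \<tau> ^ 3))) * exp (- ((x - v * \<tau>)\<^sup>2 / (4 * D * \<tau>)))"

text \<open>The integral of \<open>g(x,\<cdot>) \<phi>\<close> over \<open>[0,t]\<close>. For \<open>x = 0\<close> the kernel is by convention the
  distribution \<open>-\<delta>\<^sub>0\<close>, whatever \<open>g\<close> is, and \<open>return borel 0\<close> is the Dirac measure at \<open>0\<close>.
  For \<open>x > 0\<close> it is a Lebesgue integral, to which the value of the integrand at \<open>\<tau> = 0\<close>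
  does not contribute.\<close>

definition kernel_integral ::
    "(real \<Rightarrow> real \<Rightarrow> real) \<Rightarrow> real \<Rightarrow> real \<Rightarrow> (real \<Rightarrow> real) \<Rightarrow> real" where
  "kernel_integral g x t \<phi> =
     (if x = 0 then - (LINT \<tau>:{0..t}|return borel 0. \<phi> \<tau>)
      else (LINT \<tau>:{0..t}|lborel. g x \<tau> * \<phi> \<tau>))"

definition c_L :: "real \<Rightarrow> real \<Rightarrow> real \<Rightarrow> (real \<Rightarrow> real) \<Rightarrow> real \<Rightarrow> real \<Rightarrow> real \<Rightarrow> real" where
  "c_L D v ca0 cp L x t =
     ca0 + kernel_integral (g_L D v L) x t (\<lambda>\<tau>. ca0 - cp (t - \<tau>))"

definition c_inf :: "real \<Rightarrow> real \<Rightarrow> real \<Rightarrow> (real \<Rightarrow> real) \<Rightarrow> real \<Rightarrow> real \<Rightarrow> real" where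
  "c_inf D v ca0 cp x t =
     ca0 + kernel_integral (g_inf D v) x t (\<lambda>\<tau>. ca0 - cp (t - \<tau>))"

lemma kernel_integral_0:
  assumes "continuous_on {0..t} \<phi>" "t \<ge> 0"
  shows "kernel_integral g 0 t \<phi> = - \<phi> 0"
proof -
  have "(\<lambda>\<tau>. indicator {0..t} \<tau> *\<^sub>R \<phi> \<tau>) \<in> borel_measurable borel"
    using assms(1) by (intro borel_measurable_continuous_on_indicator) auto
  then have "(LINT \<tau>:{0..t}|return borel 0. \<phi> \<tau>) = \<phi> 0"
    using assms(2) unfolding set_lebesgue_integral_def
    by (subst integral_return) auto
  then show ?thesis
    by (simp add: kernel_integral_def)
qed

lemma c_at_0:
  assumes "continuous_on {0..} cp" "t \<ge> 0"
  shows "c_L D v ca0 cp L 0 t = cp t" and "c_inf D v ca0 cp 0 t = cp t"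
proof -
  have "continuous_on {0..t} (\<lambda>\<tau>. ca0 - cp (t - \<tau>))"
    by (intro continuous_intros continuous_on_compose2[OF assms(1)]) auto
  then show "c_L D v ca0 cp L 0 t = cp t" "c_inf D v ca0 cp 0 t = cp t"
    using assms(2) by (simp_all add: c_L_def c_inf_def kernel_integral_0)
qed

end

theory Submission
  imports Defs
begin

text \<open>The term \<open>n = 0\<close> of the series for \<open>g\<^sub>L\<close> is exactly \<open>g\<^sub>\<infinity>\<close>. Since
  \<open>exp (- z) \<le> 2 / z\<^sup>2\<close>, the term of index \<open>n \<noteq> 0\<close> is \<open>O(\<tau>\<^sup>2 / (n\<^sup>2 L))\<close>, and \<open>\<tau>\<^sup>2\<close> absorbs the
  singularity of the prefactor at \<open>\<tau> = 0\<close>. Hence \<open>g\<^sub>L - g\<^sub>\<infinity> = O(1 / L)\<close> uniformly on \<open>(0, t]\<close>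
  and the limit can be taken under the integral sign.\<close>

section \<open>Gaussian term estimates and the series over the integers\<close>

lemma exp_minus_le_inverse_square:
  fixes z :: real
  assumes "z > 0"
  shows "exp (- z) \<le> 2 / z\<^sup>2"
proof -
  have "z\<^sup>2 / 2 \<le> exp z"
    using exp_lower_Taylor_quadratic[of z] assms by simp
  then have "inverse (exp z) \<le> inverse (z\<^sup>2 / 2)"
    using assms by (intro le_imp_inverse_le) auto
  then show ?thesis
    by (simp add: exp_minus)
qed

text \<open>Take \<open>z = y\<^sup>2 / (4 * D * \<tau>)\<close> in the previous bound:
  \<open>z\<^sup>2\<close> supplies \<open>y ^ 4\<close> in the denominator, of which the factor
  \<open>y\<close> cancels one power, and \<open>\<tau>\<^sup>2\<close> in the numerator.\<close>

lemma gaussian_term_bound: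
  fixes D \<tau> y :: real
  assumes "D > 0" "\<tau> > 0" "y \<noteq> 0"
  shows "\<bar>y * exp (- (y\<^sup>2 / (4 * D * \<tau>)))\<bar> \<le> 32 * D\<^sup>2 * \<tau>\<^sup>2 / \<bar>y\<bar> ^ 3"
proof -
  have "exp (- (y\<^sup>2 / (4 * D * \<tau>))) \<le> 2 / (y\<^sup>2 / (4 * D * \<tau>))\<^sup>2"
    using assms by (intro exp_minus_le_inverse_square) auto
  then have "\<bar>y\<bar> * exp (- (y\<^sup>2 / (4 * D * \<tau>))) \<le> \<bar>y\<bar> * (2 / (\<bar>y\<bar>\<^sup>2 / (4 * D * \<tau>))\<^sup>2)"
    by (intro mult_left_mono) auto
  also have "\<dots> = 32 * D\<^sup>2 * \<tau>\<^sup>2 / \<bar>y\<bar> ^ 3"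
    using assms by (simp add: field_simps power2_eq_square power3_eq_cube)
  finally show ?thesis
    by (simp add: abs_mult)
qed

lemma summable_on_int_inverse_squares:
  "(\<lambda>n::int. 1 / (of_int n)\<^sup>2 :: real) summable_on UNIV"
proof -
  let ?f = "\<lambda>n::int. 1 / (of_int n)\<^sup>2 :: real"
  have nat: "(\<lambda>n::nat. 1 / (of_nat n)\<^sup>2 :: real) summable_on UNIV"
    by (subst summable_on_UNIV_nonneg_real_iff)
      (auto intro: inverse_power_summable[of 2, where 'a = real, simplified inverse_eq_divide])
  \<comment> \<open>The two half-lines overlap only in 0, which does no harm. There the term is
    \<open>1 / 0 = 0\<close>, so the index 0 needs no special treatment.\<close>
  have "?f summable_on (range int)"
    using nat by (subst summable_on_reindex) (auto simp: o_def inj_def)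
  moreover have "?f summable_on (range (\<lambda>n. - int n))"
    using nat by (subst summable_on_reindex) (auto simp: o_def inj_def)
  moreover have "range int \<union> range (\<lambda>n. - int n) = UNIV"
    by (auto simp: image_iff) (metis int_cases2)
  ultimately show ?thesis
    using summable_on_union by metis
qed

text \<open>Since \<open>x\<close> lies between 0 and \<open>L\<close>, the shifted points stay away
  from the origin: the modulus of \<open>x + 2 * n * L\<close> is at least (2|n| - 1) L, hence at
  least |n| L.\<close>

lemma shifted_term_bound:
  fixes D \<tau> x L :: real and n :: int
  assumes "D > 0" "\<tau> > 0" "x \<ge> 0" "L \<ge> x" "L \<ge> 1" "n \<noteq> 0"
  shows "\<bar>(x + 2 * of_int n * L) * exp (- ((x + 2 * of_int n * L)\<^sup>2 / (4 * D * \<tau>)))\<bar>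
    \<le> 32 * D\<^sup>2 * \<tau>\<^sup>2 / L * (1 / (of_int n)\<^sup>2)"
proof -
  define k where "k = \<bar>real_of_int n\<bar>"
  define y where "y = x + 2 * of_int n * L"
  have k: "k \<ge> 1"
    using assms(6) unfolding k_def by linarith
  have "\<bar>2 * of_int n * L\<bar> = 2 * (k * L)"
    using assms(5) by (simp add: k_def abs_mult)
  moreover have "1 * L \<le> k * L"
    using k assms(5) by (intro mult_right_mono) auto
  ultimately have y: "\<bar>y\<bar> \<ge> k * L"
    using assms(3,4) unfolding y_def by linarith
  have kL: "k * L > 0"
    using k assms(5) by simp
  \<comment> \<open>The cubic decay is deliberately weakened, using that \<open>k\<close> and
    \<open>L\<close> are at least 1: inverse squares in \<open>n\<close> suffice for summability,
    and one power of \<open>L\<close> for the limit.\<close>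
  have "k\<^sup>2 * L \<le> k ^ 3 * L ^ 3"
    using k assms(5) by (intro mult_mono power_increasing self_le_power) auto
  also have "\<dots> \<le> \<bar>y\<bar> ^ 3"
    using y kL by (subst power_mult_distrib[symmetric], intro power_mono) auto
  finally have le: "k\<^sup>2 * L \<le> \<bar>y\<bar> ^ 3" .
  have y0: "y \<noteq> 0"
    using y kL by auto
  have "\<bar>y * exp (- (y\<^sup>2 / (4 * D * \<tau>)))\<bar> \<le> 32 * D\<^sup>2 * \<tau>\<^sup>2 / \<bar>y\<bar> ^ 3"
    using assms y0 by (intro gaussian_term_bound) auto
  also have "\<dots> \<le> 32 * D\<^sup>2 * \<tau>\<^sup>2 / (k\<^sup>2 * L)"
    using le k y0 assms(1,2,5) by (intro divide_left_mono mult_pos_pos) auto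
  also have "\<dots> = 32 * D\<^sup>2 * \<tau>\<^sup>2 / L * (1 / (of_int n)\<^sup>2)"
    by (simp add: k_def field_simps)
  finally show ?thesis
    unfolding y_def .
qed

text \<open>The term at 0 is split off and the others are dominated by inverse squares. Summability
  is also recorded separately, since it is what permits enumerating the series by naturals
  later.\<close>

lemma image_series:
  fixes D \<tau> x L :: real
  defines "f \<equiv> \<lambda>n::int. (x + 2 * of_int n * L) * exp (- ((x + 2 * of_int n * L)\<^sup>2 / (4 * D * \<tau>)))"
  assumes "D > 0" "\<tau> > 0" "x \<ge> 0" "L \<ge> x" "L \<ge> 1"
  shows "f summable_on UNIV"
    and "\<bar>infsum f UNIV - x * exp (- (x\<^sup>2 / (4 * D * \<tau>)))\<bar>
      \<le> 32 * D\<^sup>2 * \<tau>\<^sup>2 / L * (\<Sum>\<^sub>\<infinity>n\<in>UNIV - {0::int}. 1 / (of_int n)\<^sup>2)"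
proof -
  let ?A = "UNIV - {0::int}"
  let ?q = "\<lambda>n::int. 1 / (of_int n)\<^sup>2 :: real"
  let ?g = "\<lambda>n::int. 32 * D\<^sup>2 * \<tau>\<^sup>2 / L * ?q n"
  have q: "?q summable_on ?A"
    using summable_on_int_inverse_squares by (rule summable_on_subset_banach) auto
  then have g: "?g summable_on ?A"
    by (rule summable_on_cmult_right)
  have le: "norm (f n) \<le> ?g n" if "n \<in> ?A" for n
    using shifted_term_bound[of D \<tau> x L n] assms(2-) that by (simp add: f_def)
  have f: "f summable_on ?A"
    using Infinite_Sum.abs_summable_on_comparison_test'[OF g le]
    by (rule Infinite_Sum.abs_summable_summable)
  show "f summable_on UNIV"
    using summable_on_insert_iff[of f 0 ?A] f by (simp add: insert_absorb)
  have "infsum f UNIV = f 0 + infsum f ?A"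
    using infsum_insert[OF f, of 0] by (simp add: insert_UNIV)
  moreover have "norm (infsum f ?A) \<le> infsum ?g ?A"
    using norm_infsum_le[OF has_sum_infsum[OF f] has_sum_infsum[OF g] le] by simp
  moreover have "infsum ?g ?A = 32 * D\<^sup>2 * \<tau>\<^sup>2 / L * infsum ?q ?A"
    using q by (intro infsum_cmult_right)
  ultimately show "\<bar>infsum f UNIV - x * exp (- (x\<^sup>2 / (4 * D * \<tau>)))\<bar>
      \<le> 32 * D\<^sup>2 * \<tau>\<^sup>2 / L * infsum ?q ?A"
    by (simp add: f_def)
qed

section \<open>Uniform bounds for the two kernels\<close>

lemma g_inf_eq:
  fixes D v x \<tau> :: real
  assumes "D > 0" "\<tau> > 0"
  shows "g_inf D v x \<tau> = - (exp (alpha D v * x + D * s0 D v * \<tau>) / (2 * sqrt (pi * D * \<tau> ^ 3)))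
    * (x * exp (- (x\<^sup>2 / (4 * D * \<tau>))))"
proof -
  \<comment> \<open>Expanding the square, the cross term is \<open>alpha D v * x\<close> and the
    term in \<open>v\<^sup>2\<close> is \<open>D * s0 D v * \<tau>\<close>, so both kernels share
    one prefactor.\<close>
  have "- ((x - v * \<tau>)\<^sup>2 / (4 * D * \<tau>))
      = (alpha D v * x + D * s0 D v * \<tau>) + - (x\<^sup>2 / (4 * D * \<tau>))"
    using assms by (simp add: alpha_def s0_def field_simps power2_eq_square)
  then show ?thesis
    unfolding g_inf_def by (simp only: exp_add) simp
qed

text \<open>The singularity is of order \<tau> to the power -3/2, so \<open>\<tau>\<^sup>2\<close>
  leaves a square root of \<tau>, at most that of \<open>t\<close>. The exponential in \<tau> is at
  most 1 because \<open>s0\<close> is nonpositive.\<close>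

lemma prefactor_bound:
  fixes D v x \<tau> t :: real
  assumes "D > 0" "\<tau> > 0" "\<tau> \<le> t"
  shows "\<bar>exp (alpha D v * x + D * s0 D v * \<tau>) / (2 * sqrt (pi * D * \<tau> ^ 3))\<bar> * \<tau>\<^sup>2
    \<le> exp (alpha D v * x) * sqrt (t / (pi * D))"
proof -
  have s: "sqrt (pi * D * \<tau> ^ 3) > 0"
    using assms by simp
  have "\<tau>\<^sup>2 = sqrt (\<tau> / (pi * D)) * sqrt (pi * D * \<tau> ^ 3)"
  proof -
    have "\<tau> / (pi * D) * (pi * D * \<tau> ^ 3) = (\<tau>\<^sup>2)\<^sup>2"
      using assms by (simp add: power2_eq_square power3_eq_cube)
    then have "sqrt (\<tau> / (pi * D)) * sqrt (pi * D * \<tau> ^ 3) = sqrt ((\<tau>\<^sup>2)\<^sup>2)"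
      by (simp only: real_sqrt_mult[symmetric])
    then show ?thesis
      by (simp only: real_sqrt_abs) simp
  qed
  then have t2: "\<tau>\<^sup>2 / (2 * sqrt (pi * D * \<tau> ^ 3)) = sqrt (\<tau> / (pi * D)) / 2"
    using s by (simp add: field_simps)
  have "D * s0 D v * \<tau> \<le> 0"
    using assms by (simp add: s0_def mult_nonneg_nonpos mult_nonpos_nonneg)
  then have e: "exp (alpha D v * x + D * s0 D v * \<tau>) \<le> exp (alpha D v * x)"
    by simp
  have r: "sqrt (\<tau> / (pi * D)) \<le> sqrt (t / (pi * D))"
    using assms by (intro real_sqrt_le_mono divide_right_mono) auto
  have "\<bar>exp (alpha D v * x + D * s0 D v * \<tau>) / (2 * sqrt (pi * D * \<tau> ^ 3))\<bar> * \<tau>\<^sup>2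
      = exp (alpha D v * x + D * s0 D v * \<tau>) * (sqrt (\<tau> / (pi * D)) / 2)"
    using s by (simp add: t2[symmetric])
  also have "\<dots> \<le> exp (alpha D v * x) * sqrt (t / (pi * D))"
  proof (rule mult_mono)
    have "0 \<le> sqrt (\<tau> / (pi * D))"
      using assms by simp
    then show "sqrt (\<tau> / (pi * D)) / 2 \<le> sqrt (t / (pi * D))"
      using r by linarith
  qed (use e assms in auto)
  finally show ?thesis .
qed

text \<open>The right-hand side is free of \<tau>, so this one estimate serves both the pointwise
  limit and the domination.\<close>

lemma g_L_minus_g_inf_bound:
  fixes D v x \<tau> t L :: real
  assumes "D > 0" "\<tau> > 0" "\<tau> \<le> t" "x \<ge> 0" "L \<ge> x" "L \<ge> 1"
  shows "\<bar>g_L D v L x \<tau> - g_inf D v x \<tau>\<bar>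
    \<le> exp (alpha D v * x) * sqrt (t / (pi * D)) * (32 * D\<^sup>2)
      * (\<Sum>\<^sub>\<infinity>n\<in>UNIV - {0::int}. 1 / (of_int n)\<^sup>2) / L"
proof -
  define P where "P = exp (alpha D v * x + D * s0 D v * \<tau>) / (2 * sqrt (pi * D * \<tau> ^ 3))"
  define S where "S = (\<Sum>\<^sub>\<infinity>n\<in>(UNIV :: int set).
      (x + 2 * of_int n * L) * exp (- ((x + 2 * of_int n * L)\<^sup>2 / (4 * D * \<tau>))))"
  define T where "T = x * exp (- (x\<^sup>2 / (4 * D * \<tau>)))"
  define K where "K = (\<Sum>\<^sub>\<infinity>n\<in>UNIV - {0::int}. 1 / (of_int n)\<^sup>2 :: real)"
  have K: "K \<ge> 0"
    unfolding K_def by (intro infsum_nonneg) auto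
  have "g_L D v L x \<tau> - g_inf D v x \<tau> = - P * (S - T)"
    using assms by (simp add: g_L_def g_inf_eq P_def S_def T_def right_diff_distrib)
  then have "\<bar>g_L D v L x \<tau> - g_inf D v x \<tau>\<bar> = \<bar>P\<bar> * \<bar>S - T\<bar>"
    by (simp add: abs_mult)
  also have "\<dots> \<le> \<bar>P\<bar> * (32 * D\<^sup>2 * \<tau>\<^sup>2 / L * K)"
    using image_series(2)[of D \<tau> x L] assms unfolding S_def T_def K_def
    by (intro mult_left_mono) auto
  also have "\<dots> = \<bar>P\<bar> * \<tau>\<^sup>2 * (32 * D\<^sup>2 * K / L)"
    by simp
  also have "\<dots> \<le> exp (alpha D v * x) * sqrt (t / (pi * D)) * (32 * D\<^sup>2 * K / L)"
    using prefactor_bound[of D \<tau> t v x] assms K unfolding P_def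
    by (intro mult_right_mono) auto
  finally show ?thesis
    by (simp add: K_def)
qed

text \<open>The term at 0 gains nothing from \<open>L\<close>; its control near \<tau> = 0 comes
  from \<open>x > 0\<close>, through \<open>gaussian_term_bound\<close> at
  \<open>y = x\<close>.\<close>

lemma g_inf_bound:
  fixes D v x \<tau> t :: real
  assumes "D > 0" "\<tau> > 0" "\<tau> \<le> t" "x > 0"
  shows "\<bar>g_inf D v x \<tau>\<bar> \<le> exp (alpha D v * x) * sqrt (t / (pi * D)) * (32 * D\<^sup>2) / x ^ 3"
proof -
  define P where "P = exp (alpha D v * x + D * s0 D v * \<tau>) / (2 * sqrt (pi * D * \<tau> ^ 3))"
  have "\<bar>g_inf D v x \<tau>\<bar> = \<bar>P\<bar> * \<bar>x * exp (- (x\<^sup>2 / (4 * D * \<tau>)))\<bar>"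
    using assms by (simp only: g_inf_eq P_def abs_mult abs_minus_cancel)
  also have "\<dots> \<le> \<bar>P\<bar> * (32 * D\<^sup>2 * \<tau>\<^sup>2 / \<bar>x\<bar> ^ 3)"
    using gaussian_term_bound[of D \<tau> x] assms by (intro mult_left_mono) auto
  also have "\<dots> = \<bar>P\<bar> * \<tau>\<^sup>2 * (32 * D\<^sup>2 / x ^ 3)"
    using assms by simp
  also have "\<dots> \<le> exp (alpha D v * x) * sqrt (t / (pi * D)) * (32 * D\<^sup>2 / x ^ 3)"
    using prefactor_bound[of D \<tau> t v x] assms unfolding P_def
    by (intro mult_right_mono) auto
  finally show ?thesis
    by simp
qed

section \<open>Measurability and dominated convergence\<close>

lemma g_L_measurable:
  fixes D v x t L :: real
  assumes "D > 0" "x \<ge> 0" "L \<ge> x" "L \<ge> 1"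
  shows "(\<lambda>\<tau>. indicator {0<..t} \<tau> * g_L D v L x \<tau>) \<in> borel_measurable borel"
proof -
  let ?f = "\<lambda>\<tau> n. (x + 2 * of_int n * L) * exp (- ((x + 2 * of_int n * L)\<^sup>2 / (4 * D * \<tau>)))"
  \<comment> \<open>Enumerating the integers turns the unordered sum into a limit of partial sums,
    whose measurability in \<tau> is automatic. Convergence is known for \<tau> > 0, hence the
    indicator.\<close>
  have eq: "infsum (?f \<tau>) UNIV = (\<Sum>n. ?f \<tau> (int_decode n))" if "\<tau> > 0" for \<tau>
  proof -
    have "?f \<tau> summable_on UNIV"
      using image_series(1)[of D \<tau> x L] assms that by simp
    then have "(\<lambda>n. ?f \<tau> (int_decode n)) summable_on UNIV"
      using summable_on_reindex_bij_betw[OF bij_int_decode, of "?f \<tau>"] by simp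
    then have "(\<lambda>n. ?f \<tau> (int_decode n)) sums infsum (\<lambda>n. ?f \<tau> (int_decode n)) UNIV"
      by (intro has_sum_imp_sums has_sum_infsum)
    then show ?thesis
      using infsum_reindex_bij_betw[OF bij_int_decode, of "?f \<tau>"] by (simp add: sums_iff)
  qed
  have "(\<lambda>\<tau>. indicator {0<..t} \<tau> * g_L D v L x \<tau>) =
      (\<lambda>\<tau>. indicator {0<..t} \<tau> *
        (- (exp (alpha D v * x + D * s0 D v * \<tau>) / (2 * sqrt (pi * D * \<tau> ^ 3)))
          * (\<Sum>n. ?f \<tau> (int_decode n))))"
    unfolding g_L_def by (intro ext) (auto simp: indicator_def eq)
  then show ?thesis
    by simp
qed

theorem corollary5p1:
  fixes D v ca0 x t :: real and cp cp' :: "real \<Rightarrow> real"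
  assumes "D > 0"
    and "\<And>s. s \<ge> 0 \<Longrightarrow> (cp has_real_derivative cp' s) (at s within {0..})"
    and "continuous_on {0..} cp'"
    and "x \<ge> 0" and "t > 0"
  shows "((\<lambda>L. c_L D v ca0 cp L x t) \<longlongrightarrow> c_inf D v ca0 cp x t) at_top"
proof -
  have cont: "continuous_on {0..} cp"
    using assms(2) by (intro DERIV_continuous_on) auto
  show ?thesis
  proof (cases "x = 0")
    case True
    then show ?thesis
      using c_at_0[OF cont, of t] assms(5) by simp
  next
    case False
    then have x: "x > 0"
      using assms(4) by simp
    define \<phi> where "\<phi> = (\<lambda>\<tau>. ca0 - cp (t - \<tau>))"
    define \<psi> where "\<psi> = (\<lambda>\<tau>. indicator {0..t} \<tau> * \<phi> \<tau>)"
    have \<phi>: "continuous_on {0..t} \<phi>"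
      unfolding \<phi>_def by (intro continuous_intros continuous_on_compose2[OF cont]) auto
    have \<psi>[measurable]: "\<psi> \<in> borel_measurable borel"
      using borel_measurable_continuous_on_indicator[OF _ \<phi>] by (simp add: \<psi>_def)
    have "bounded (\<phi> ` {0..t})"
      using compact_continuous_image[OF \<phi>] compact_imp_bounded by auto
    then obtain M where M: "M > 0" "\<And>\<tau>. \<tau> \<in> {0..t} \<Longrightarrow> \<bar>\<phi> \<tau>\<bar> \<le> M"
      unfolding bounded_pos by auto
    define C where "C = exp (alpha D v * x) * sqrt (t / (pi * D)) * (32 * D\<^sup>2)"
    define K where "K = (\<Sum>\<^sub>\<infinity>n\<in>UNIV - {0::int}. 1 / (of_int n)\<^sup>2 :: real)"
    have C: "C \<ge> 0"
      unfolding C_def using assms by simp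
    have K: "K \<ge> 0"
      unfolding K_def by (intro infsum_nonneg) auto
    define L0 where "L0 = max x 1"
    have diff: "\<bar>g_L D v L x \<tau> - g_inf D v x \<tau>\<bar> \<le> C * K / L"
      if "\<tau> \<in> {0<..t}" "L \<ge> L0" for \<tau> L
      using g_L_minus_g_inf_bound[of D \<tau> t x L v] that assms
      by (simp add: C_def K_def L0_def)
    \<comment> \<open>Truncated in \<open>L\<close> because dominated convergence asks for measurability at every \<open>L\<close>.\<close>
    define F where "F = (\<lambda>L \<tau>. if L \<ge> L0 then indicator {0<..t} \<tau> * g_L D v L x \<tau> * \<psi> \<tau> else 0)"
    define G where "G = (\<lambda>\<tau>. indicator {0<..t} \<tau> * g_inf D v x \<tau> * \<psi> \<tau>)"
    \<comment> \<open>Triangle inequality: \<open>C / x ^ 3\<close> bounds \<open>g_inf\<close>, and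
      \<open>C * K\<close> bounds the difference of the kernels because \<open>L\<close> is at least
      1.\<close>
    define w where "w = (\<lambda>\<tau>. (C * K + C / x ^ 3) * M * indicator {0..t} \<tau>)"
    have lim: "((\<lambda>L. integral\<^sup>L lborel (F L)) \<longlongrightarrow> integral\<^sup>L lborel G) at_top"
    proof (rule integral_dominated_convergence_at_top[where w = w])
      show "G \<in> borel_measurable lborel"
        unfolding G_def g_inf_def by measurable
      show "F L \<in> borel_measurable lborel" for L
      proof (cases "L \<ge> L0")
        case True
        then have [measurable]: "(\<lambda>\<tau>. indicator {0<..t} \<tau> * g_L D v L x \<tau>) \<in> borel_measurable borel"
          using assms by (intro g_L_measurable) (auto simp: L0_def)
        show ?thesis
          using True by (simp add: F_def)
      qed (simp add: F_def)
      show "integrable lborel w"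
        unfolding w_def
        by (intro integrable_mult_right integrable_real_indicator) (auto simp: emeasure_lborel_Icc_eq)
      show "AE \<tau> in lborel. ((\<lambda>L. F L \<tau>) \<longlongrightarrow> G \<tau>) at_top"
      proof (intro AE_I2)
        fix \<tau>
        show "((\<lambda>L. F L \<tau>) \<longlongrightarrow> G \<tau>) at_top"
        proof (cases "\<tau> \<in> {0<..t}")
          case True
          have "\<forall>\<^sub>F L in at_top. norm (g_L D v L x \<tau> - g_inf D v x \<tau>) \<le> C * K / L"
            unfolding real_norm_def
            using eventually_ge_at_top[of L0] by eventually_elim (rule diff[OF True])
          moreover have "((\<lambda>L. C * K / L) \<longlongrightarrow> 0) at_top"
            by (intro tendsto_divide_0[OF tendsto_const] filterlim_at_top_imp_at_infinity filterlim_ident)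
          ultimately have "((\<lambda>L. g_L D v L x \<tau> - g_inf D v x \<tau>) \<longlongrightarrow> 0) at_top"
            by (rule Lim_null_comparison)
          then have "((\<lambda>L. g_L D v L x \<tau>) \<longlongrightarrow> g_inf D v x \<tau>) at_top"
            by (simp add: LIM_zero_iff)
          then have "((\<lambda>L. g_L D v L x \<tau> * \<psi> \<tau>) \<longlongrightarrow> G \<tau>) at_top"
            using True by (auto simp: G_def intro!: tendsto_intros)
          moreover have "\<forall>\<^sub>F L in at_top. g_L D v L x \<tau> * \<psi> \<tau> = F L \<tau>"
            using eventually_ge_at_top[of L0] by eventually_elim (use True in \<open>simp add: F_def\<close>)
          ultimately show ?thesis
            by (rule Lim_transform_eventually)
        next
          case False
          then have "F L \<tau> = 0" for L
            by (simp add: F_def)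
          with False show ?thesis
            by (simp add: G_def)
        qed
      qed
      have "norm (F L \<tau>) \<le> w \<tau>" if L: "L \<ge> L0" for L \<tau>
      proof (cases "\<tau> \<in> {0<..t}")
        case True
        have "\<bar>g_inf D v x \<tau>\<bar> \<le> C / x ^ 3"
          using g_inf_bound[of D \<tau> t x v] True x assms by (simp add: C_def)
        moreover have "C * K / L \<le> C * K / 1"
          using L C K by (intro divide_left_mono) (auto simp: L0_def)
        ultimately have "\<bar>g_L D v L x \<tau>\<bar> \<le> C * K + C / x ^ 3"
          using diff[OF True L] by linarith
        moreover have "\<bar>\<phi> \<tau>\<bar> \<le> M"
          using M(2) True by simp
        ultimately have "\<bar>g_L D v L x \<tau>\<bar> * \<bar>\<phi> \<tau>\<bar> \<le> (C * K + C / x ^ 3) * M"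
          using C K x by (intro mult_mono) auto
        then show ?thesis
          using True L by (simp add: F_def w_def \<psi>_def abs_mult)
      next
        case False
        then show ?thesis
          using C K x M(1) by (simp add: F_def w_def)
      qed
      then show "\<forall>\<^sub>F L in at_top. AE \<tau> in lborel. norm (F L \<tau>) \<le> w \<tau>"
        by (intro eventually_mono[OF eventually_ge_at_top[of L0]] AE_I2)
    qed
    \<comment> \<open>The integrands agree even at \<tau> = 0: the prefactor divides by
      \<open>sqrt 0\<close>, so the kernel takes the value 0 there. The same holds for
      \<open>g_inf\<close> below.\<close>
    have "(LINT \<tau>:{0..t}|lborel. g_L D v L x \<tau> * \<phi> \<tau>) = integral\<^sup>L lborel (F L)" if "L \<ge> L0" for L
      unfolding set_lebesgue_integral_def F_def \<psi>_def using that
      by (intro Bochner_Integration.integral_cong) (auto simp: indicator_def g_L_def)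
    then have "\<forall>\<^sub>F L in at_top. ca0 + integral\<^sup>L lborel (F L) = c_L D v ca0 cp L x t"
      using False
      by (intro eventually_mono[OF eventually_ge_at_top[of L0]])
        (simp add: c_L_def kernel_integral_def \<phi>_def)
    moreover have "(LINT \<tau>:{0..t}|lborel. g_inf D v x \<tau> * \<phi> \<tau>) = integral\<^sup>L lborel G"
      unfolding set_lebesgue_integral_def G_def \<psi>_def
      by (intro Bochner_Integration.integral_cong) (auto simp: indicator_def g_inf_def)
    then have "c_inf D v ca0 cp x t = ca0 + integral\<^sup>L lborel G"
      using False by (simp add: c_inf_def kernel_integral_def \<phi>_def)
    ultimately show ?thesis
      using tendsto_add[OF tendsto_const lim, of ca0] by (auto intro: Lim_transform_eventually)
  qed
qed

end
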